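(* Let $A\in\mathbb{R}_+^{n\times n}$ be a definite visualized matrix and let $m$ be the number of strongly connected components of $C^*(A)$. Let $N_1,\dots,N_m$, $A^C=(\alpha_{\mu\nu})\in\mathbb{R}_+^{m\times m}$ and $I_1,\dots,I_m$ be as defined in the context. Let $X=\operatorname{diag}(x)$ with $x\in\mathbb{R}_+^n$ positive. Then $X^{-1}AX$ is visualized (resp. strictly visualized) if and only if $X$ has the form $$X=\tilde{x}_1I_1+\cdots+\tilde{x}_mI_m,$$ where $\tilde{x}=(\tilde x_1,\dots,\tilde x_m)$ is a (positive) vector satisfying $\alpha_{\mu\nu}\tilde{x}_\nu\le\tilde{x}_\mu$ (resp. $\alpha_{\mu\nu}\tilde{x}_\nu<\tilde{x}_\mu$) for all $\mu,\nu\in[m]$ with $\mu\ne\nu$. In other words, $\tilde{x}\in V^*(A^C)$ (resp. $\tilde{x}\in\operatorname{int}(V^*(A^C))$).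
   Context: $\mathbb{R}_+$ is the set of nonnegative reals, $n\ge 1$, $[n]=\{1,\dots,n\}$. Max-algebraic product: $(A\otimes y)_i=\max_j a_{ij}y_j$. For $A=(a_{ij})\in\mathbb{R}_+^{n\times n}$, the digraph $D_A$ has node set $[n]$ and all edges $(i,j)\in[n]\times[n]$ with weights $a_{ij}$. A cycle $(i_1,\dots,i_k,i_1)$, $k\ge1$, has geometric mean $(a_{i_1i_2}\cdots a_{i_ki_1})^{1/k}$. $\lambda(A)$ is the maximum of the geometric means over all cycles. $A$ is definite if $\lambda(A)=1$. A cycle is critical if its geometric mean equals $\lambda(A)$; $N_c(A)$ and $E_c(A)$ are the sets of nodes and edges that belong to critical cycles; $C(A)=(N_c(A),E_c(A))$ is the critical digraph. $C^*(A)$ is the digraph with node set $[n]$ and edge set $E_c^*(A)$ containing all loops $(i,i)$, $i\in[n]$, and, for $i\ne j$, containing $(i,j)$ if and only if there is a path from $i$ to $j$ in $C(A)$. A matrix $B=(b_{ij})\in\mathbb{R}_+^{n\times n}$ is visualized (resp. strictly visualized) if $b_{ij}=\lambda(B)$ for all $(i,j)\in E_c(B)$ and $b_{ij}\le\lambda(B)$ (resp. $b_{ij}<\lambda(B)$) for all $(i,j)\notin E_c(B)$. The subeigencone of a matrix $B\in\mathbb{R}_+^{m\times m}$ is $V^*(B)=\{y\in\mathbb{R}_+^m: B\otimes y\le\lambda(B)y\}$, and $\operatorname{int}$ denotes the interior in $\mathbb{R}^m$. Let $C_1,\dots,C_m$ be the strongly connected components of $C^*(A)$ and $N_\mu$ the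 node set of $C_\mu$. $A^C\in\mathbb{R}_+^{m\times m}$ is the matrix with entries $\alpha_{\mu\nu}=\max\{a_{ij}: i\in N_\mu,\ j\in N_\nu\}$. $I_\mu$ is the $n\times n$ matrix with $(I_\mu)_{ij}=1$ if $i=j\in N_\mu$ and $(I_\mu)_{ij}=0$ otherwise. $\operatorname{diag}(x)$ is the diagonal matrix with diagonal entries $x_1,\dots,x_n$; positive means all components are $>0$. *)

theory Defs
  imports "HOL-Analysis.Analysis" "Graph_Theory.Digraph_Component"
begin

section \<open>Cycles in the weighted digraph of a square matrix\<close>

text \<open>
  Every pair of indices is an arc of the digraph of a square matrix; the matrix entries enter only
  as arc weights.
\<close>

definition full_digraph :: "('n, 'n \<times> 'n) pre_digraph" where
  "full_digraph = with_proj \<lparr>pverts = UNIV, parcs = UNIV\<rparr>"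

lemma full_digraph_simps [simp]:
  "verts full_digraph = UNIV" "arcs full_digraph = UNIV"
  "tail full_digraph = fst" "head full_digraph = snd"
  by (simp_all add: full_digraph_def)

lemma wf_full_digraph: "wf_digraph full_digraph"
  by unfold_locales auto

definition walk_weight :: "real^'n^'n \<Rightarrow> ('n \<times> 'n) list \<Rightarrow> real" where
  "walk_weight A p = (\<Prod>(i, j)\<leftarrow>p. A $ i $ j)"

definition geom_mean :: "real^'n^'n \<Rightarrow> ('n \<times> 'n) list \<Rightarrow> real" where
  "geom_mean A p = root (length p) (walk_weight A p)"

text \<open>
  A cycle is a closed walk of length at least 1, given by its list of arcs; its nodes need not be
  distinct.  There may be infinitely many cycles, hence \<open>GREATEST\<close> rather than
  \<^const>\<open>Max\<close>. For a nonnegative matrix the maximum is attained, see \<open>max_cycle_mean_is_max\<close>.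
\<close>

definition max_cycle_mean :: "real^'n^'n \<Rightarrow> real" where
  "max_cycle_mean A = (GREATEST r. \<exists>p. wf_digraph.closed_w full_digraph p \<and> r = geom_mean A p)"

lemma walk_weight_nonneg: "(\<And>i j. 0 \<le> A $ i $ j) \<Longrightarrow> 0 \<le> walk_weight A p"
  by (induction p) (auto simp: walk_weight_def)

lemma geom_mean_nonneg: "(\<And>i j. 0 \<le> A $ i $ j) \<Longrightarrow> 0 \<le> geom_mean A p"
  by (cases "p = []") (simp_all add: geom_mean_def walk_weight_nonneg)

lemma max_cycle_mean_exists:
  fixes A :: "real^'n^'n"
  assumes nonneg: "\<And>i j. 0 \<le> A $ i $ j"
  shows "\<exists>p. wf_digraph.closed_w full_digraph p \<and>
    (\<forall>q. wf_digraph.closed_w full_digraph q \<longrightarrow> geom_mean A q \<le> geom_mean A p)"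
proof -
  interpret wf_digraph "full_digraph :: ('n, 'n \<times> 'n) pre_digraph"
    by (rule wf_full_digraph)
  have fin: "finite {p. cycle p}"
  proof (rule finite_subset)
    show "{p. cycle p} \<subseteq> {p. set p \<subseteq> UNIV \<and> distinct p}"
      by (auto simp: cycle_conv)
    show "finite {p :: ('n \<times> 'n) list. set p \<subseteq> UNIV \<and> distinct p}"
      using finite_subset_distinct[of "UNIV :: ('n \<times> 'n) set"] by simp
  qed
  have "cycle [(i, i)]" for i :: 'n
    by (auto simp: cycle_def awalk_def)
  then have ne: "{p. cycle p} \<noteq> {}"
    by blast
  define r where "r = Max (geom_mean A ` {p. cycle p})"
  have "r \<in> geom_mean A ` {p. cycle p}"
    unfolding r_def using fin ne by (intro Max_in) auto
  then obtain p where p: "cycle p" "geom_mean A p = r"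
    by auto
  have r_ge: "geom_mean A q \<le> r" if "cycle q" for q
    unfolding r_def using fin that by (intro Max_ge) auto
  have r0: "0 \<le> r"
    using p(2) geom_mean_nonneg[OF nonneg] by blast
  have bound: "walk_weight A q \<le> r ^ length q" if "awalk u q u" for u q
    using that
  proof (induction q arbitrary: u rule: length_induct)
    case (1 q)
    consider "q = []" | "cycle q" | "q \<noteq> []" "\<not> cycle q"
      by blast
    then show ?case
    proof cases
      case 1
      then show ?thesis by (simp add: walk_weight_def)
    next
      case 2
      then have "0 < length q"
        by (auto simp: cycle_def)
      then have "geom_mean A q ^ length q = walk_weight A q"
        using walk_weight_nonneg[OF nonneg] by (simp add: geom_mean_def)
      moreover have "0 \<le> geom_mean A q"
        by (rule geom_mean_nonneg[OF nonneg])
      ultimately show ?thesis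
        using power_mono[OF r_ge[OF 2]] by metis
    next
      case 3
      from \<open>q \<noteq> []\<close> obtain e q' where q: "q = e # q'"
        by (cases q) auto
      have aw: "awalk (head full_digraph e) q' u" "tail full_digraph e = u"
        "e \<in> arcs full_digraph"
        using 1(2) by (auto simp: q awalk_Cons_iff)
      have nd: "\<not> distinct (awalk_verts (head full_digraph e) q')"
        using 3 1(2) by (auto simp: cycle_def q)
      obtain a b c where abc: "q' = a @ b @ c" "b \<noteq> []"
        "\<exists>w. awalk (head full_digraph e) a w \<and> awalk w b w \<and> awalk w c u"
        using awalk_not_distinct_decomp[OF aw(1) nd] by auto
      then obtain w where w: "awalk (head full_digraph e) a w" "awalk w b w" "awalk w c u"
        by blast
      have "awalk u (e # a @ c) u"
        using w aw by (auto simp: awalk_Cons_iff)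
      moreover have "length (e # a @ c) < length q" "length b < length q"
        using abc by (auto simp: q)
      ultimately have "walk_weight A (e # a @ c) \<le> r ^ length (e # a @ c)"
        "walk_weight A b \<le> r ^ length b"
        using 1(1) w(2) by blast+
      then have "walk_weight A (e # a @ c) * walk_weight A b
          \<le> r ^ length (e # a @ c) * r ^ length b"
        using walk_weight_nonneg[OF nonneg] r0 by (intro mult_mono) auto
      also have "walk_weight A (e # a @ c) * walk_weight A b = walk_weight A q"
        by (simp add: q abc(1) walk_weight_def)
      also have "r ^ length (e # a @ c) * r ^ length b = r ^ length q"
        by (simp add: q abc(1) power_add mult_ac)
      finally show ?thesis .
    qed
  qed
  have "geom_mean A q \<le> r" if "closed_w q" for q
  proof -
    from that obtain u where "awalk u q u" "0 < length q"
      by (auto simp: closed_w_def)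
    then have "geom_mean A q \<le> root (length q) (r ^ length q)"
      unfolding geom_mean_def using bound by (intro real_root_le_mono) auto
    then show ?thesis
      using r0 \<open>0 < length q\<close> by (simp add: real_root_power_cancel)
  qed
  then show ?thesis
    using p by (auto simp: cycle_altdef)
qed

lemma max_cycle_mean_is_max:
  fixes A :: "real^'n^'n"
  assumes "\<And>i j. 0 \<le> A $ i $ j"
  shows "\<exists>p. wf_digraph.closed_w full_digraph p \<and> geom_mean A p = max_cycle_mean A"
    and "wf_digraph.closed_w full_digraph q \<Longrightarrow> geom_mean A q \<le> max_cycle_mean A"
proof -
  obtain p where p: "wf_digraph.closed_w full_digraph p"
    "\<And>q. wf_digraph.closed_w full_digraph q \<Longrightarrow> geom_mean A q \<le> geom_mean A p"
    using max_cycle_mean_exists[OF assms] by blast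
  then have "max_cycle_mean A = geom_mean A p"
    unfolding max_cycle_mean_def by (intro Greatest_equality) auto
  then show "\<exists>p. wf_digraph.closed_w full_digraph p \<and> geom_mean A p = max_cycle_mean A"
    and "wf_digraph.closed_w full_digraph q \<Longrightarrow> geom_mean A q \<le> max_cycle_mean A"
    using p by auto
qed

definition definite :: "real^'n^'n \<Rightarrow> bool" where
  "definite A \<longleftrightarrow> max_cycle_mean A = 1"


section \<open>Critical digraph\<close>

definition critical_cycle :: "real^'n^'n \<Rightarrow> ('n \<times> 'n) list \<Rightarrow> bool" where
  "critical_cycle A p \<longleftrightarrow>
    wf_digraph.closed_w full_digraph p \<and> geom_mean A p = max_cycle_mean A"

text \<open>Every node of a cycle is the tail of one of its arcs.\<close>

definition critical_nodes :: "real^'n^'n \<Rightarrow> 'n set" where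
  "critical_nodes A = {i. \<exists>p. critical_cycle A p \<and> i \<in> fst ` set p}"

definition critical_edges :: "real^'n^'n \<Rightarrow> ('n \<times> 'n) set" where
  "critical_edges A = {e. \<exists>p. critical_cycle A p \<and> e \<in> set p}"

definition critical_digraph :: "real^'n^'n \<Rightarrow> ('n, 'n \<times> 'n) pre_digraph" where
  "critical_digraph A = with_proj \<lparr>pverts = critical_nodes A, parcs = critical_edges A\<rparr>"

definition critical_closure :: "real^'n^'n \<Rightarrow> ('n, 'n \<times> 'n) pre_digraph" where
  "critical_closure A = with_proj
    \<lparr>pverts = UNIV, parcs = {(i, j). i = j \<or> i \<noteq> j \<and> i \<rightarrow>\<^sup>*\<^bsub>critical_digraph A\<^esub> j}\<rparr>"

definition visualized :: "real^'n^'n \<Rightarrow> bool" where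
  "visualized B \<longleftrightarrow>
    (\<forall>i j. (i, j) \<in> critical_edges B \<longrightarrow> B $ i $ j = max_cycle_mean B) \<and>
    (\<forall>i j. (i, j) \<notin> critical_edges B \<longrightarrow> B $ i $ j \<le> max_cycle_mean B)"

definition strictly_visualized :: "real^'n^'n \<Rightarrow> bool" where
  "strictly_visualized B \<longleftrightarrow>
    (\<forall>i j. (i, j) \<in> critical_edges B \<longrightarrow> B $ i $ j = max_cycle_mean B) \<and>
    (\<forall>i j. (i, j) \<notin> critical_edges B \<longrightarrow> B $ i $ j < max_cycle_mean B)"


section \<open>Subeigencone and block matrices\<close>

definition max_mult_vec :: "real^'n^'m \<Rightarrow> real^'n \<Rightarrow> real^'m" where
  "max_mult_vec A y = (\<chi> i. Max (range (\<lambda>j. A $ i $ j * y $ j)))"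

text \<open>The order on vectors is the componentwise one.\<close>

definition subeigencone :: "real^'m^'m \<Rightarrow> (real^'m) set" where
  "subeigencone B = {y. 0 \<le> y \<and> max_mult_vec B y \<le> max_cycle_mean B *\<^sub>R y}"

definition block_max :: "real^'n^'n \<Rightarrow> ('m \<Rightarrow> 'n set) \<Rightarrow> real^'m^'m" where
  "block_max A N = (\<chi> \<mu> \<nu>. Max {A $ i $ j | i j. i \<in> N \<mu> \<and> j \<in> N \<nu>})"

definition diag :: "real^'n \<Rightarrow> real^'n^'n" where
  "diag x = (\<chi> i j. if i = j then x $ i else 0)"

definition partial_identity :: "'n set \<Rightarrow> real^'n^'n" where
  "partial_identity S = (\<chi> i j. if i = j \<and> i \<in> S then 1 else 0)"

end

(*
  A diagonal similarity multiplies the weight of a walk from u to v by x_v / x_u, so it preserves the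
  weights of closed walks, hence the maximum cycle mean and the critical edges. Visualization of
  the scaled matrix therefore says that x is constant along critical edges and
  a_ij x_j <= x_i elsewhere. Every critical edge lies on a critical cycle, so critical
  reachability is symmetric and the components are its classes; constancy along critical edges is
  constancy on components. Inside a component a noncritical edge has weight < 1: an edge of weight 1
  would close up with a critical path, all of whose weights are 1, to a critical cycle. So only the
  inequalities between distinct components matter, and these are the ones involving the block
  matrix. The block matrix has entries at most 1 and a diagonal entry 1, hence maximum cycle mean 1.
*)

theory Submission
  imports Defs
begin

section \<open>Walks and diagonal similarity\<close>

lemma closed_w_full_digraph:
  "wf_digraph.closed_w full_digraph p \<longleftrightarrow>
    p \<noteq> [] \<and> (\<exists>u. pre_digraph.awalk full_digraph u p u)"
  unfolding wf_digraph.closed_w_def[OF wf_full_digraph] by auto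

lemma awalk_full_digraph_Nil [simp]:
  "pre_digraph.awalk full_digraph u [] v \<longleftrightarrow> u = v"
  by (simp add: wf_digraph.awalk_Nil_iff[OF wf_full_digraph])

lemma awalk_full_digraph_Cons [simp]:
  "pre_digraph.awalk full_digraph u (e # p) v \<longleftrightarrow>
    u = fst e \<and> pre_digraph.awalk full_digraph (snd e) p v"
  by (auto simp: wf_digraph.awalk_Cons_iff[OF wf_full_digraph])

lemma awalk_full_digraph_append [simp]:
  "pre_digraph.awalk full_digraph u (p @ q) v \<longleftrightarrow>
    (\<exists>w. pre_digraph.awalk full_digraph u p w \<and> pre_digraph.awalk full_digraph w q v)"
  by (induction p arbitrary: u) auto

text \<open>Passes from relational reachability to arc lists, which can be closed up to cycles. The
  walk lives in the full digraph; membership in \<open>E\<close> is imposed on its arcs.\<close>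

lemma rtrancl_iff_awalk:
  "(u, v) \<in> E\<^sup>* \<longleftrightarrow> (\<exists>p. pre_digraph.awalk full_digraph u p v \<and> set p \<subseteq> E)"
proof
  assume "(u, v) \<in> E\<^sup>*"
  then show "\<exists>p. pre_digraph.awalk full_digraph u p v \<and> set p \<subseteq> E"
  proof (induction rule: converse_rtrancl_induct)
    case base
    show ?case by (rule exI[of _ "[]"]) simp
  next
    case (step i j)
    then obtain p where "pre_digraph.awalk full_digraph j p v" "set p \<subseteq> E" by blast
    then show ?case using step.hyps by (intro exI[of _ "(i, j) # p"]) simp
  qed
next
  assume "\<exists>p. pre_digraph.awalk full_digraph u p v \<and> set p \<subseteq> E"
  then obtain p where "pre_digraph.awalk full_digraph u p v" "set p \<subseteq> E" by blast
  then show "(u, v) \<in> E\<^sup>*"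
    by (induction p arbitrary: u) (force intro: converse_rtrancl_into_rtrancl)+
qed

lemma walk_weight_eq_1:
  assumes "\<And>i j. (i, j) \<in> set p \<Longrightarrow> A $ i $ j = 1"
  shows "walk_weight A p = 1"
  using assms by (induction p) (auto simp: walk_weight_def)

lemma walk_weight_le_1:
  assumes "\<And>i j. 0 \<le> A $ i $ j" "\<And>i j. A $ i $ j \<le> 1"
  shows "walk_weight A p \<le> 1"
proof (induction p)
  case (Cons e p)
  then show ?case
    using assms walk_weight_nonneg[of A p, OF assms(1)]
    by (auto simp: walk_weight_def intro!: mult_le_one split: prod.split)
qed (simp add: walk_weight_def)

section \<open>Entries and invariants of a diagonal similarity\<close>

lemma matrix_inv_eqI:
  fixes A :: "'a::semiring_1^'n^'m"
  assumes "A ** B = mat 1" "B ** A = mat 1"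
  shows "matrix_inv A = B"
proof -
  \<comment> \<open>\<open>matrix_inv\<close> is a Hilbert choice, so its defining property needs
    the witness \<open>B\<close>.\<close>
  have "A ** matrix_inv A = mat 1 \<and> matrix_inv A ** A = mat 1"
    unfolding matrix_inv_def by (rule someI[of _ B]) (use assms in blast)
  then have "B ** A ** matrix_inv A = B"
    by (simp flip: matrix_mul_assoc)
  then show ?thesis
    by (simp add: assms(2))
qed

lemma diag_nth: "diag u $ i $ j = (if i = j then u $ i else 0)"
  by (simp add: diag_def)

lemma diag_mult_left: "(diag u ** M) $ i $ j = u $ i * M $ i $ j"
proof -
  have "(\<Sum>k\<in>UNIV. diag u $ i $ k * M $ k $ j) =
      (\<Sum>k\<in>UNIV. if k = i then u $ i * M $ i $ j else 0)"
    by (rule sum.cong) (auto simp: diag_nth)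
  then show ?thesis
    by (simp add: matrix_matrix_mult_def)
qed

lemma diag_mult_right: "(M ** diag u) $ i $ j = M $ i $ j * u $ j"
proof -
  have "(\<Sum>k\<in>UNIV. M $ i $ k * diag u $ k $ j) =
      (\<Sum>k\<in>UNIV. if k = j then M $ i $ j * u $ j else 0)"
    by (rule sum.cong) (auto simp: diag_nth)
  then show ?thesis
    by (simp add: matrix_matrix_mult_def)
qed

lemma diag_similarity_nth:
  fixes A :: "real^'n^'n"
  assumes "\<And>i. x $ i \<noteq> 0"
  shows "(matrix_inv (diag x) ** A ** diag x) $ i $ j = A $ i $ j * x $ j / x $ i"
proof -
  define z :: "real^'n" where "z = (\<chi> i. 1 / x $ i)"
  have "diag x ** diag z = mat 1" "diag z ** diag x = mat 1"
    using assms by (auto simp: vec_eq_iff diag_mult_left diag_nth mat_def z_def)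
  then have "matrix_inv (diag x) = diag z"
    by (rule matrix_inv_eqI)
  then show ?thesis
    by (simp add: diag_mult_left diag_mult_right z_def)
qed

text \<open>Each arc contributes a factor x_j / x_i, and these factors telescope along the
  walk.\<close>

lemma walk_weight_similarity:
  assumes "\<And>i j. B $ i $ j = A $ i $ j * x $ j / x $ i" "\<And>i. x $ i \<noteq> 0"
    and "pre_digraph.awalk full_digraph u p v"
  shows "walk_weight B p = walk_weight A p * x $ v / x $ u"
  using assms(3)
proof (induction p arbitrary: u)
  case Nil
  then show ?case using assms(2) by (simp add: walk_weight_def)
next
  case (Cons e p)
  then show ?case using assms(1,2) by (cases e) (auto simp: walk_weight_def)
qed

text \<open>On a closed walk the telescoped factor is 1, so all cycle means agree; the maximum and
  the critical cycles are determined by them.\<close>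

lemma similarity_invariants:
  fixes A B :: "real^'n^'n"
  assumes "\<And>i j. B $ i $ j = A $ i $ j * x $ j / x $ i" "\<And>i. x $ i \<noteq> 0"
  shows "max_cycle_mean B = max_cycle_mean A" "critical_edges B = critical_edges A"
proof -
  have gm: "geom_mean B p = geom_mean A p" if "wf_digraph.closed_w full_digraph p" for p
    using that walk_weight_similarity[OF assms] assms(2)
    by (auto simp: geom_mean_def closed_w_full_digraph)
  then have "(\<exists>p. wf_digraph.closed_w full_digraph p \<and> r = geom_mean B p) \<longleftrightarrow>
      (\<exists>p. wf_digraph.closed_w full_digraph p \<and> r = geom_mean A p)" for r
    by metis
  then show mean: "max_cycle_mean B = max_cycle_mean A"
    by (simp add: max_cycle_mean_def)
  then have "critical_cycle B p \<longleftrightarrow> critical_cycle A p" for p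
    using gm by (auto simp: critical_cycle_def)
  then show "critical_edges B = critical_edges A"
    by (simp add: critical_edges_def)
qed


section \<open>The critical digraph\<close>

text \<open>The arcs of a critical cycle after (i, j), followed by those before it, lead from j back
  to i.\<close>

lemma sym_rtrancl_critical_edges: "sym ((critical_edges A)\<^sup>*)"
proof -
  have "(j, i) \<in> (critical_edges A)\<^sup>*" if "(i, j) \<in> critical_edges A" for i j
  proof -
    from that obtain p where p: "critical_cycle A p" "(i, j) \<in> set p"
      by (auto simp: critical_edges_def)
    from p(1) have sub: "set p \<subseteq> critical_edges A"
      by (auto simp: critical_edges_def)
    from p(2) obtain q r where qr: "p = q @ (i, j) # r"
      by (meson split_list)
    from p(1) obtain u where "pre_digraph.awalk full_digraph u p u"
      by (auto simp: critical_cycle_def closed_w_full_digraph)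
    then have "pre_digraph.awalk full_digraph j (r @ q) i"
      by (auto simp: qr)
    then show ?thesis
      using sub unfolding rtrancl_iff_awalk qr by (intro exI[of _ "r @ q"]) auto
  qed
  then have "(critical_edges A)\<inverse> \<subseteq> (critical_edges A)\<^sup>*"
    by auto
  then have "((critical_edges A)\<^sup>*)\<inverse> \<subseteq> (critical_edges A)\<^sup>*"
    by (metis rtrancl_converse rtrancl_subset_rtrancl)
  then show ?thesis
    by (auto intro: symI)
qed

section \<open>Components of the closure as classes of critical reachability\<close>

lemma critical_closure_simps [simp]:
  "verts (critical_closure A) = UNIV"
  "arcs (critical_closure A) = {(i, j). i = j \<or> i \<noteq> j \<and> i \<rightarrow>\<^sup>*\<^bsub>critical_digraph A\<^esub> j}"
  "tail (critical_closure A) = fst" "head (critical_closure A) = snd"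
  by (simp_all add: critical_closure_def)

lemma wf_critical_closure: "wf_digraph (critical_closure A)"
  by unfold_locales simp_all

lemma critical_nodesI:
  "(i, j) \<in> critical_edges A \<Longrightarrow> i \<in> critical_nodes A"
  by (force simp: critical_edges_def critical_nodes_def)

lemma arcs_ends_critical_digraph: "arcs_ends (critical_digraph A) = critical_edges A"
  by (simp add: arcs_ends_def arc_to_ends_def critical_digraph_def)

text \<open>\<open>critical_nodes\<close> collects tails only, so heads need an argument: the head
  of a critical edge starts a critical walk back to the tail, or equals the tail.\<close>

lemma wf_critical_digraph: "wf_digraph (critical_digraph A)"
proof
  fix e assume "e \<in> arcs (critical_digraph A)"
  then obtain i j where e: "e = (i, j)" "(i, j) \<in> critical_edges A"
    by (cases e) (simp add: critical_digraph_def)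
  then have "(j, i) \<in> (critical_edges A)\<^sup>*"
    using sym_rtrancl_critical_edges by (meson r_into_rtrancl symE)
  then have "j \<in> critical_nodes A"
    using e(2) by (metis converse_rtranclE critical_nodesI)
  then show "tail (critical_digraph A) e \<in> verts (critical_digraph A)"
    "head (critical_digraph A) e \<in> verts (critical_digraph A)"
    using e by (auto simp: critical_digraph_def intro: critical_nodesI)
qed

text \<open>The arcs of the closure already form a reflexive transitive relation, so walks along
  them reach nothing new.\<close>

lemma reachable_critical_closure:
  "i \<rightarrow>\<^sup>*\<^bsub>critical_closure A\<^esub> j \<longleftrightarrow> (i, j) \<in> (critical_edges A)\<^sup>*"
proof -
  \<comment> \<open>Reachability in a digraph requires the nodes to belong to it, so a noncritical
    node does not reach itself in \<open>critical_digraph A\<close>. Hence the restriction to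
    distinct nodes; the loops of the closure restore reflexivity.\<close>
  have crit: "i \<rightarrow>\<^sup>*\<^bsub>critical_digraph A\<^esub> j \<longleftrightarrow> (i, j) \<in> (critical_edges A)\<^sup>*"
    if "i \<noteq> j" for i j
  proof
    assume "i \<rightarrow>\<^sup>*\<^bsub>critical_digraph A\<^esub> j"
    then show "(i, j) \<in> (critical_edges A)\<^sup>*"
      using reachable_rtranclI[of "critical_digraph A" i j]
      by (simp add: arcs_ends_critical_digraph)
  next
    assume "(i, j) \<in> (critical_edges A)\<^sup>*"
    then have "(i, j) \<in> (arcs_ends (critical_digraph A))\<^sup>+"
      using that by (auto simp: arcs_ends_critical_digraph rtrancl_eq_or_trancl)
    then show "i \<rightarrow>\<^sup>*\<^bsub>critical_digraph A\<^esub> j"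
      by (rule wf_digraph.reachable1_reachable[OF wf_critical_digraph])
  qed
  have "arcs_ends (critical_closure A) = (critical_edges A)\<^sup>*"
    using crit by (auto simp: arcs_ends_def arc_to_ends_def)
  then show ?thesis
    by (simp add: wf_digraph.reachable_conv[OF wf_critical_closure])
qed

lemma sccs_verts_critical_closure:
  "pre_digraph.sccs_verts (critical_closure A) = UNIV // (critical_edges A)\<^sup>*"
proof -
  have "(i, j) \<in> (critical_edges A)\<^sup>* \<longleftrightarrow> (j, i) \<in> (critical_edges A)\<^sup>*" for i j
    using sym_rtrancl_critical_edges by (meson symE)
  then show ?thesis
    by (auto simp: wf_digraph.sccs_verts_conv_scc_of[OF wf_critical_closure]
        pre_digraph.scc_of_def reachable_critical_closure quotient_def)
qed

lemma equiv_critical: "equiv UNIV ((critical_edges A)\<^sup>*)"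
  by (intro equivI refl_onI sym_rtrancl_critical_edges trans_rtrancl) auto

lemma bij_betw_component_nodes:
  assumes "bij_betw C UNIV (pre_digraph.sccs (critical_closure A))"
  shows "bij_betw (\<lambda>\<mu>. verts (C \<mu>)) UNIV (UNIV // (critical_edges A)\<^sup>*)"
proof -
  have "bij_betw verts (pre_digraph.sccs (critical_closure A))
      (pre_digraph.sccs_verts (critical_closure A))"
    by (simp add: bij_betw_def wf_digraph.inj_on_verts_sccs[OF wf_critical_closure]
        wf_digraph.sccs_verts_conv[OF wf_critical_closure])
  then show ?thesis
    using bij_betw_trans[OF assms] by (simp add: sccs_verts_critical_closure o_def)
qed

text \<open>Supplies the critical edge from which the block matrix gets a diagonal entry 1.\<close>

lemma critical_edges_nonempty:
  assumes "\<And>i j. 0 \<le> A $ i $ j"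
  obtains i j where "(i, j) \<in> critical_edges A"
proof -
  obtain p where "critical_cycle A p"
    using max_cycle_mean_is_max(1)[OF assms] by (auto simp: critical_cycle_def)
  moreover from this obtain i j where "(i, j) \<in> set p"
    by (cases p) (auto simp: critical_cycle_def closed_w_full_digraph)
  ultimately show thesis
    using that by (auto simp: critical_edges_def)
qed

text \<open>Closing the edge with a critical walk from \<open>j\<close> to \<open>i\<close> gives a
  cycle of weights 1, which is critical by definiteness.\<close>

lemma critical_edgeI:
  assumes "definite A"
    and one: "\<And>k l. (k, l) \<in> critical_edges A \<Longrightarrow> A $ k $ l = 1"
    and "(j, i) \<in> (critical_edges A)\<^sup>*" "A $ i $ j = 1"
  shows "(i, j) \<in> critical_edges A"
proof -
  obtain p where p: "pre_digraph.awalk full_digraph j p i" "set p \<subseteq> critical_edges A"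
    using assms(3) unfolding rtrancl_iff_awalk by blast
  have "walk_weight A ((i, j) # p) = 1"
    using p(2) one assms(4) by (intro walk_weight_eq_1) auto
  then have "critical_cycle A ((i, j) # p)"
    using p(1) assms(1)
    by (auto simp: critical_cycle_def closed_w_full_digraph geom_mean_def definite_def)
  then show ?thesis
    by (force simp: critical_edges_def)
qed


section \<open>Subeigencones\<close>

text \<open>The loop at \<open>k\<close> has mean 1, and no cycle exceeds 1 since its weight is a
  product of entries at most 1.\<close>

lemma max_cycle_mean_eq_1:
  assumes "\<And>i j. 0 \<le> A $ i $ j" "\<And>i j. A $ i $ j \<le> 1" "A $ k $ k = 1"
  shows "max_cycle_mean A = 1"
proof (rule antisym)
  obtain p where p: "wf_digraph.closed_w full_digraph p" "geom_mean A p = max_cycle_mean A"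
    using max_cycle_mean_is_max(1)[OF assms(1)] by blast
  from p(1) have "geom_mean A p \<le> 1"
    using walk_weight_le_1[OF assms(1,2), of p]
    by (simp add: geom_mean_def closed_w_full_digraph)
  then show "max_cycle_mean A \<le> 1"
    using p by simp
  have "geom_mean A [(k, k)] = 1"
    using assms(3) by (simp add: geom_mean_def walk_weight_def)
  then show "1 \<le> max_cycle_mean A"
    using max_cycle_mean_is_max(2)[OF assms(1), of "[(k, k)]"]
    by (simp add: closed_w_full_digraph)
qed

lemma mem_subeigencone_iff:
  "y \<in> subeigencone B \<longleftrightarrow>
    (\<forall>\<mu>. 0 \<le> y $ \<mu>) \<and> (\<forall>\<mu> \<nu>. B $ \<mu> $ \<nu> * y $ \<nu> \<le> max_cycle_mean B * y $ \<mu>)"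
  by (auto simp: subeigencone_def max_mult_vec_def less_eq_vec_def)

text \<open>Strict inequalities survive small perturbations, whereas a tight one fails once its
  right-hand coordinate is lowered. The diagonal inequalities hold at every nonnegative vector
  because the diagonal entries are at most 1.\<close>

lemma interior_subeigencone_iff:
  fixes B :: "real^'m^'m"
  assumes "max_cycle_mean B = 1" "\<And>\<mu>. B $ \<mu> $ \<mu> \<le> 1" "\<And>\<mu>. 0 < y $ \<mu>"
  shows "y \<in> interior (subeigencone B) \<longleftrightarrow>
    (\<forall>\<mu> \<nu>. \<mu> \<noteq> \<nu> \<longrightarrow> B $ \<mu> $ \<nu> * y $ \<nu> < y $ \<mu>)"
proof
  assume "y \<in> interior (subeigencone B)"
  then obtain e where e: "0 < e" "cball y e \<subseteq> subeigencone B"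
    by (auto simp: mem_interior_cball)
  show "\<forall>\<mu> \<nu>. \<mu> \<noteq> \<nu> \<longrightarrow> B $ \<mu> $ \<nu> * y $ \<nu> < y $ \<mu>"
  proof (intro allI impI)
    fix \<mu> \<nu> :: 'm assume "\<mu> \<noteq> \<nu>"
    \<comment> \<open>Lowering coordinate \<mu> alone by \<open>e\<close> reduces the right side by
      \<open>e\<close> and keeps the left side, as \<nu> differs from \<mu>; this leaves a strict
      inequality at \<open>y\<close>.\<close>
    have "y - e *\<^sub>R axis \<mu> 1 \<in> cball y e"
      using e(1) by (simp add: dist_norm norm_axis_1)
    then have "B $ \<mu> $ \<nu> * (y - e *\<^sub>R axis \<mu> 1) $ \<nu> \<le> (y - e *\<^sub>R axis \<mu> 1) $ \<mu>"
      using subsetD[OF e(2)] assms(1) unfolding mem_subeigencone_iff by (metis mult_1)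
    then show "B $ \<mu> $ \<nu> * y $ \<nu> < y $ \<mu>"
      using e(1) \<open>\<mu> \<noteq> \<nu>\<close> by (simp add: axis_def)
  qed
next
  assume strict: "\<forall>\<mu> \<nu>. \<mu> \<noteq> \<nu> \<longrightarrow> B $ \<mu> $ \<nu> * y $ \<nu> < y $ \<mu>"
  \<comment> \<open>A finite intersection of open half-spaces; those for positivity keep it in the
    nonnegative orthant.\<close>
  let ?U = "(\<Inter>\<mu>. {z. 0 < z $ \<mu>}) \<inter>
    (\<Inter>\<mu>. \<Inter>\<nu>\<in>- {\<mu>}. {z :: real^'m. B $ \<mu> $ \<nu> * z $ \<nu> < z $ \<mu>})"
  have "open ?U"
    by (intro open_Int open_INT ballI finite open_Collect_less continuous_intros)
  moreover have "y \<in> ?U"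
    using strict assms(3) by auto
  moreover have "?U \<subseteq> subeigencone B"
  proof
    fix z assume z: "z \<in> ?U"
    have "B $ \<mu> $ \<nu> * z $ \<nu> \<le> z $ \<mu>" for \<mu> \<nu>
    proof (cases "\<mu> = \<nu>")
      case True
      then show ?thesis
        using z assms(2)[of \<nu>] mult_right_mono[of "B $ \<nu> $ \<nu>" 1 "z $ \<nu>"]
        by (auto intro: less_imp_le)
    next
      case False
      then show ?thesis
        using z by (auto intro: less_imp_le)
    qed
    then show "z \<in> subeigencone B"
      using z assms(1) by (auto simp: mem_subeigencone_iff intro: less_imp_le)
  qed
  ultimately show "y \<in> interior (subeigencone B)"
    by (rule interiorI[rotated -1, rotated])
qed


section \<open>Blocks\<close>

lemma finite_block:
  fixes A :: "real^'n^'n"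
  shows "finite {A $ i $ j | i j. i \<in> S \<and> j \<in> T}"
  by (rule finite_subset[of _ "(\<lambda>(i, j). A $ i $ j) ` UNIV"]) auto

lemma block_max_ge:
  "i \<in> N \<mu> \<Longrightarrow> j \<in> N \<nu> \<Longrightarrow> A $ i $ j \<le> block_max A N $ \<mu> $ \<nu>"
  unfolding block_max_def by (auto intro!: Max_ge finite_block)

lemma block_max_attained:
  assumes "N \<mu> \<noteq> {}" "N \<nu> \<noteq> {}"
  obtains i j where "i \<in> N \<mu>" "j \<in> N \<nu>" "block_max A N $ \<mu> $ \<nu> = A $ i $ j"
proof -
  have "block_max A N $ \<mu> $ \<nu> \<in> {A $ i $ j | i j. i \<in> N \<mu> \<and> j \<in> N \<nu>}"
    unfolding block_max_def vec_lambda_beta using assms by (intro Max_in finite_block) auto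
  then show thesis
    using that by auto
qed

text \<open>The blocks partition the indices, so only the summand of the block containing i
  contributes to row i.\<close>

lemma diag_eq_sum_partial_identity:
  fixes x :: "real^'n" and y :: "real^'m::finite"
  assumes cover: "\<And>i. \<exists>\<mu>. i \<in> N \<mu>"
    and disj: "\<And>i \<mu> \<nu>. i \<in> N \<mu> \<Longrightarrow> i \<in> N \<nu> \<Longrightarrow> \<mu> = \<nu>"
  shows "diag x = (\<Sum>\<mu>\<in>UNIV. y $ \<mu> *\<^sub>R partial_identity (N \<mu>)) \<longleftrightarrow>
    (\<forall>\<mu>. \<forall>i\<in>N \<mu>. x $ i = y $ \<mu>)"
proof -
  let ?S = "\<Sum>\<mu>\<in>UNIV. y $ \<mu> *\<^sub>R partial_identity (N \<mu>)"
  have S: "?S $ i $ j = (if i = j then y $ \<kappa> else 0)" if "i \<in> N \<kappa>" for i j \<kappa>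
  proof -
    have "i \<in> N \<mu> \<longleftrightarrow> \<mu> = \<kappa>" for \<mu>
      using that disj by blast
    then have "?S $ i $ j = (\<Sum>\<mu>\<in>UNIV. if \<mu> = \<kappa> then (if i = j then y $ \<kappa> else 0) else 0)"
      unfolding sum_component by (intro sum.cong) (auto simp: partial_identity_def)
    then show ?thesis
      by simp
  qed
  show ?thesis
  proof
    assume eq: "diag x = ?S"
    show "\<forall>\<mu>. \<forall>i\<in>N \<mu>. x $ i = y $ \<mu>"
      using S[of i _ i for i] by (auto simp: diag_nth simp flip: eq)
  next
    assume eq: "\<forall>\<mu>. \<forall>i\<in>N \<mu>. x $ i = y $ \<mu>"
    have "diag x $ i $ j = ?S $ i $ j" for i j
    proof -
      obtain \<kappa> where \<kappa>: "i \<in> N \<kappa>"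
        using cover by blast
      then show ?thesis
        unfolding S[OF \<kappa>] diag_nth using eq \<kappa> by auto
    qed
    then show "diag x = ?S"
      by (simp add: vec_eq_iff)
  qed
qed

text \<open>The index set [m] is modelled by the finite type \<open>'m\<close>: the bijection
  \<open>C\<close> forces its size to be the number of components. The last two conjuncts carry the
  reformulation by the cone and its interior.\<close>

theorem theorem4p2:
  fixes A :: "real^'n^'n"
    and C :: "'m::finite \<Rightarrow> ('n, 'n \<times> 'n) pre_digraph"
    and N :: "'m \<Rightarrow> 'n set"
    and x :: "real^'n"
    and X :: "real^'n^'n"
  assumes nonneg: "\<forall>i j. 0 \<le> A $ i $ j"
    and definite: "definite A"
    and visualized: "visualized A"
    and components: "bij_betw C UNIV (pre_digraph.sccs (critical_closure A))"
    and component_nodes: "\<forall>\<mu>. N \<mu> = verts (C \<mu>)"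
    and x_pos: "\<forall>i. 0 < x $ i"
    and X_diag: "X = diag x"
  shows "(visualized (matrix_inv X ** A ** X) \<longleftrightarrow>
      (\<exists>y :: real^'m. (\<forall>\<mu>. 0 < y $ \<mu>) \<and>
        X = (\<Sum>\<mu>\<in>UNIV. y $ \<mu> *\<^sub>R partial_identity (N \<mu>)) \<and>
        (\<forall>\<mu> \<nu>. \<mu> \<noteq> \<nu> \<longrightarrow> block_max A N $ \<mu> $ \<nu> * y $ \<nu> \<le> y $ \<mu>))) \<and>
    (strictly_visualized (matrix_inv X ** A ** X) \<longleftrightarrow>
      (\<exists>y :: real^'m. (\<forall>\<mu>. 0 < y $ \<mu>) \<and>
        X = (\<Sum>\<mu>\<in>UNIV. y $ \<mu> *\<^sub>R partial_identity (N \<mu>)) \<and>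
        (\<forall>\<mu> \<nu>. \<mu> \<noteq> \<nu> \<longrightarrow> block_max A N $ \<mu> $ \<nu> * y $ \<nu> < y $ \<mu>))) \<and>
    (\<forall>y :: real^'m. (\<forall>\<mu>. 0 < y $ \<mu>) \<longrightarrow>
      ((\<forall>\<mu> \<nu>. \<mu> \<noteq> \<nu> \<longrightarrow> block_max A N $ \<mu> $ \<nu> * y $ \<nu> \<le> y $ \<mu>)
        \<longleftrightarrow> y \<in> subeigencone (block_max A N))) \<and>
    (\<forall>y :: real^'m. (\<forall>\<mu>. 0 < y $ \<mu>) \<longrightarrow>
      ((\<forall>\<mu> \<nu>. \<mu> \<noteq> \<nu> \<longrightarrow> block_max A N $ \<mu> $ \<nu> * y $ \<nu> < y $ \<mu>)
        \<longleftrightarrow> y \<in> interior (subeigencone (block_max A N))))"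
proof -
  let ?E = "critical_edges A" and ?B = "matrix_inv X ** A ** X"
  note A0 = nonneg[rule_format] and x0 = x_pos[rule_format]
  have x_nz: "x $ i \<noteq> 0" for i
    using x0[of i] by simp
  have mean: "max_cycle_mean A = 1"
    using definite by (simp add: definite_def)
  have crit1: "A $ i $ j = 1" if "(i, j) \<in> ?E" for i j
    using visualized that mean by (simp add: visualized_def)
  have le1: "A $ i $ j \<le> 1" for i j
    using visualized mean crit1[of i j] by (cases "(i, j) \<in> ?E") (auto simp: visualized_def)

  \<comment> \<open>The blocks as a partition of the nodes\<close>
  have "N = (\<lambda>\<mu>. verts (C \<mu>))"
    using component_nodes by auto
  then have N: "inj N" "range N = UNIV // ?E\<^sup>*"
    using bij_betw_component_nodes[OF components] by (auto simp: bij_betw_def)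
  have N_ne: "N \<mu> \<noteq> {}" for \<mu>
    using N(2) in_quotient_imp_non_empty[OF equiv_critical] by blast
  have cover: "\<exists>\<mu>. i \<in> N \<mu>" for i
  proof -
    have "?E\<^sup>* `` {i} \<in> range N"
      unfolding N(2) by (intro quotientI) simp
    then show ?thesis
      by (metis Image_singleton_iff imageE rtrancl.rtrancl_refl)
  qed
  \<comment> \<open>Injectivity of \<open>N\<close> turns equality of classes into equality of
    indices, so later block arguments reduce to critical reachability.\<close>
  have same_iff: "\<mu> = \<nu> \<longleftrightarrow> (i, j) \<in> ?E\<^sup>*" if "i \<in> N \<mu>" "j \<in> N \<nu>" for i j \<mu> \<nu>
  proof -
    have "N \<mu> \<in> UNIV // ?E\<^sup>*" "N \<nu> \<in> UNIV // ?E\<^sup>*"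
      using N(2) by auto
    then show ?thesis
      using quotient_eq_iff[OF equiv_critical _ _ that] N(1) by (simp add: inj_eq)
  qed
  have disj: "\<mu> = \<nu>" if "i \<in> N \<mu>" "i \<in> N \<nu>" for i \<mu> \<nu>
    using same_iff[OF that] by simp
  \<comment> \<open>Contrapositive of \<open>critical_edgeI\<close>: within one class a critical
    walk leads from \<open>j\<close> back to \<open>i\<close>.\<close>
  have lt1: "A $ i $ j < 1" if "(i, j) \<notin> ?E" "i \<in> N \<mu>" "j \<in> N \<mu>" for i j \<mu>
    using critical_edgeI[OF definite crit1, of j i] same_iff[OF that(3,2)] that(1) le1[of i j]
    by fastforce

  \<comment> \<open>Visualization of the scaled matrix in terms of x\<close>
  have B: "?B $ i $ j = A $ i $ j * x $ j / x $ i" for i j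
    unfolding X_diag by (rule diag_similarity_nth[OF x_nz])
  note inv = similarity_invariants[OF B x_nz, unfolded mean]
  \<comment> \<open>By \<open>inv\<close> the mean is 1 and the critical edges are those of
    \<open>A\<close>. On such an edge the scaled entry is x_j / x_i, which is 1 exactly when the
    coordinates agree.\<close>
  have vis: "visualized ?B \<longleftrightarrow> (\<forall>i j. (i, j) \<in> ?E \<longrightarrow> x $ i = x $ j) \<and>
      (\<forall>i j. (i, j) \<notin> ?E \<longrightarrow> A $ i $ j * x $ j \<le> x $ i)"
    using x0 crit1 by (auto simp: visualized_def inv B x_nz divide_le_eq_1_pos)
  have svis: "strictly_visualized ?B \<longleftrightarrow> (\<forall>i j. (i, j) \<in> ?E \<longrightarrow> x $ i = x $ j) \<and>
      (\<forall>i j. (i, j) \<notin> ?E \<longrightarrow> A $ i $ j * x $ j < x $ i)"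
    using x0 crit1 by (auto simp: strictly_visualized_def inv B x_nz divide_less_eq_1_pos)
  note X_iff = diag_eq_sum_partial_identity[where N = N and x = x, OF cover disj, folded X_diag]

  have const: "\<exists>y :: real^'m. \<forall>\<mu>. \<forall>i\<in>N \<mu>. x $ i = y $ \<mu>"
    if crit: "\<forall>i j. (i, j) \<in> ?E \<longrightarrow> x $ i = x $ j"
  proof -
    have "x $ i = x $ j" if "(i, j) \<in> ?E\<^sup>*" for i j
      using that by (induction rule: rtrancl_induct) (use crit in auto)
    \<comment> \<open>The value of \<open>y\<close> on a block is taken at a chosen representative,
      which every node of the block reaches along critical edges.\<close>
    moreover have "(i, SOME k. k \<in> N \<mu>) \<in> ?E\<^sup>*" if "i \<in> N \<mu>" for i \<mu>
      using same_iff[OF that someI[of "\<lambda>k. k \<in> N \<mu>", OF that]] by simp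
    ultimately show ?thesis
      by (intro exI[of _ "\<chi> \<mu>. x $ (SOME k. k \<in> N \<mu>)"]) simp
  qed
  have y_pos: "0 < y $ \<mu>" if "\<forall>\<mu>. \<forall>i\<in>N \<mu>. x $ i = y $ \<mu>" for y :: "real^'m" and \<mu>
    using that N_ne[of \<mu>] x0 by (metis all_not_in_conv)
  have crit_const: "x $ i = x $ j" if "\<forall>\<mu>. \<forall>i\<in>N \<mu>. x $ i = y $ \<mu>" "(i, j) \<in> ?E"
    for y :: "real^'m" and i j
    using that cover[of i] cover[of j] same_iff by (metis r_into_rtrancl)
  have block_le: "block_max A N $ \<mu> $ \<nu> \<le> 1" and block_nonneg: "0 \<le> block_max A N $ \<mu> $ \<nu>"
    for \<mu> \<nu>
    using block_max_attained[of N \<mu> \<nu> A, OF N_ne N_ne] A0 le1 by metis+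

  \<comment> \<open>The two equivalences for the scaling\<close>
  have vis_iff: "visualized ?B \<longleftrightarrow>
      (\<exists>y :: real^'m. (\<forall>\<mu>. 0 < y $ \<mu>) \<and>
        X = (\<Sum>\<mu>\<in>UNIV. y $ \<mu> *\<^sub>R partial_identity (N \<mu>)) \<and>
        (\<forall>\<mu> \<nu>. \<mu> \<noteq> \<nu> \<longrightarrow> block_max A N $ \<mu> $ \<nu> * y $ \<nu> \<le> y $ \<mu>))"
    (is "_ \<longleftrightarrow> ?R")
  proof
    assume "visualized ?B"
    then have v: "\<forall>i j. (i, j) \<in> ?E \<longrightarrow> x $ i = x $ j"
      "\<forall>i j. (i, j) \<notin> ?E \<longrightarrow> A $ i $ j * x $ j \<le> x $ i"
      by (simp_all add: vis)
    from const[OF v(1)] obtain y :: "real^'m" where y: "\<forall>\<mu>. \<forall>i\<in>N \<mu>. x $ i = y $ \<mu>" ..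
    have "block_max A N $ \<mu> $ \<nu> * y $ \<nu> \<le> y $ \<mu>" if "\<mu> \<noteq> \<nu>" for \<mu> \<nu>
    proof -
      \<comment> \<open>The edge attaining the block maximum joins distinct blocks, so it is
        noncritical and \<open>v(2)\<close> applies.\<close>
      obtain i j where "i \<in> N \<mu>" "j \<in> N \<nu>" "block_max A N $ \<mu> $ \<nu> = A $ i $ j"
        using block_max_attained[of N \<mu> \<nu> A, OF N_ne N_ne] .
      then show ?thesis
        using v(2) y that same_iff by (metis r_into_rtrancl)
    qed
    then show ?R
      using y y_pos[OF y] by (auto simp: X_iff)
  next
    assume ?R
    then obtain y :: "real^'m" where y: "\<And>\<mu>. 0 < y $ \<mu>" "\<forall>\<mu>. \<forall>i\<in>N \<mu>. x $ i = y $ \<mu>"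
      "\<And>\<mu> \<nu>. \<mu> \<noteq> \<nu> \<Longrightarrow> block_max A N $ \<mu> $ \<nu> * y $ \<nu> \<le> y $ \<mu>"
      by (auto simp: X_iff)
    have "A $ i $ j * x $ j \<le> x $ i" for i j
    proof -
      obtain \<mu> \<nu> where mn: "i \<in> N \<mu>" "j \<in> N \<nu>"
        using cover by blast
      have "A $ i $ j * y $ \<nu> \<le> block_max A N $ \<mu> $ \<nu> * y $ \<nu>" "A $ i $ j * y $ \<nu> \<le> 1 * y $ \<nu>"
        using block_max_ge[of i N \<mu> j \<nu> A, OF mn] y(1)[of \<nu>] le1[of i j]
        by (intro mult_right_mono; simp)+
      \<comment> \<open>Between distinct blocks the block maximum bounds the weight; within one
        block the weight is at most 1 and x_i = x_j.\<close>
      then show ?thesis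
        using y(2,3) mn by (cases "\<mu> = \<nu>") (auto intro: order_trans)
    qed
    then show "visualized ?B"
      using crit_const[OF y(2)] by (simp add: vis)
  qed
  have svis_iff: "strictly_visualized ?B \<longleftrightarrow>
      (\<exists>y :: real^'m. (\<forall>\<mu>. 0 < y $ \<mu>) \<and>
        X = (\<Sum>\<mu>\<in>UNIV. y $ \<mu> *\<^sub>R partial_identity (N \<mu>)) \<and>
        (\<forall>\<mu> \<nu>. \<mu> \<noteq> \<nu> \<longrightarrow> block_max A N $ \<mu> $ \<nu> * y $ \<nu> < y $ \<mu>))"
    (is "_ \<longleftrightarrow> ?R")
  proof
    assume "strictly_visualized ?B"
    then have v: "\<forall>i j. (i, j) \<in> ?E \<longrightarrow> x $ i = x $ j"
      "\<forall>i j. (i, j) \<notin> ?E \<longrightarrow> A $ i $ j * x $ j < x $ i"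
      by (simp_all add: svis)
    from const[OF v(1)] obtain y :: "real^'m" where y: "\<forall>\<mu>. \<forall>i\<in>N \<mu>. x $ i = y $ \<mu>" ..
    have "block_max A N $ \<mu> $ \<nu> * y $ \<nu> < y $ \<mu>" if "\<mu> \<noteq> \<nu>" for \<mu> \<nu>
    proof -
      obtain i j where "i \<in> N \<mu>" "j \<in> N \<nu>" "block_max A N $ \<mu> $ \<nu> = A $ i $ j"
        using block_max_attained[of N \<mu> \<nu> A, OF N_ne N_ne] .
      then show ?thesis
        using v(2) y that same_iff by (metis r_into_rtrancl)
    qed
    then show ?R
      using y y_pos[OF y] by (auto simp: X_iff)
  next
    assume ?R
    then obtain y :: "real^'m" where y: "\<And>\<mu>. 0 < y $ \<mu>" "\<forall>\<mu>. \<forall>i\<in>N \<mu>. x $ i = y $ \<mu>"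
      "\<And>\<mu> \<nu>. \<mu> \<noteq> \<nu> \<Longrightarrow> block_max A N $ \<mu> $ \<nu> * y $ \<nu> < y $ \<mu>"
      by (auto simp: X_iff)
    have "A $ i $ j * x $ j < x $ i" if "(i, j) \<notin> ?E" for i j
    proof -
      obtain \<mu> \<nu> where mn: "i \<in> N \<mu>" "j \<in> N \<nu>"
        using cover by blast
      show ?thesis
      proof (cases "\<mu> = \<nu>")
        \<comment> \<open>Within a block the bound 1 alone gives only a weak inequality;
          noncriticality makes it strict through \<open>lt1\<close>.\<close>
        case True
        then show ?thesis
          using lt1[OF that, of \<mu>] mn y(2) y(1)[of \<nu>] by auto
      next
        case False
        have "A $ i $ j * y $ \<nu> \<le> block_max A N $ \<mu> $ \<nu> * y $ \<nu>"
          using block_max_ge[of i N \<mu> j \<nu> A, OF mn] y(1)[of \<nu>] by (intro mult_right_mono; simp)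
        then show ?thesis
          using y(2) mn y(3)[OF False] by simp
      qed
    qed
    then show "strictly_visualized ?B"
      using crit_const[OF y(2)] by (simp add: svis)
  qed

  \<comment> \<open>The subeigencone of the block matrix\<close>
  have mean_block: "max_cycle_mean (block_max A N) = 1"
  proof -
    obtain i j where ij: "(i, j) \<in> ?E"
      using critical_edges_nonempty[of A, OF A0] .
    \<comment> \<open>A critical edge stays within one block, and its weight 1 forces the diagonal
      entry there to be 1.\<close>
    obtain \<mu> where "i \<in> N \<mu>" "j \<in> N \<mu>"
      using ij cover same_iff by (metis r_into_rtrancl)
    then have "block_max A N $ \<mu> $ \<mu> = 1"
      using block_max_ge[of i N \<mu> j \<mu> A] crit1[OF ij] block_le[of \<mu> \<mu>] by simp
    then show ?thesis
      using block_nonneg block_le by (rule max_cycle_mean_eq_1[rotated 2])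
  qed
  have sub_iff: "(\<forall>\<mu> \<nu>. \<mu> \<noteq> \<nu> \<longrightarrow> block_max A N $ \<mu> $ \<nu> * y $ \<nu> \<le> y $ \<mu>)
      \<longleftrightarrow> y \<in> subeigencone (block_max A N)" if pos: "\<forall>\<mu>. 0 < y $ \<mu>" for y :: "real^'m"
  proof -
    \<comment> \<open>For positive \<open>y\<close> the diagonal inequalities follow from entries at
      most 1, so quantifying over all pairs adds no constraint.\<close>
    have "block_max A N $ \<mu> $ \<nu> * y $ \<nu> \<le> y $ \<mu>" if "\<mu> = \<nu>" for \<mu> \<nu>
      using mult_right_mono[OF block_le[of \<nu> \<nu>], of "y $ \<nu>"] pos that by (simp add: less_imp_le)
    then have "(\<forall>\<mu> \<nu>. \<mu> \<noteq> \<nu> \<longrightarrow> block_max A N $ \<mu> $ \<nu> * y $ \<nu> \<le> y $ \<mu>) \<longleftrightarrow>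
        (\<forall>\<mu> \<nu>. block_max A N $ \<mu> $ \<nu> * y $ \<nu> \<le> y $ \<mu>)"
      by blast
    then show ?thesis
      using pos by (simp add: mem_subeigencone_iff mean_block less_imp_le)
  qed
  have int_iff: "(\<forall>\<mu> \<nu>. \<mu> \<noteq> \<nu> \<longrightarrow> block_max A N $ \<mu> $ \<nu> * y $ \<nu> < y $ \<mu>)
      \<longleftrightarrow> y \<in> interior (subeigencone (block_max A N))" if "\<forall>\<mu>. 0 < y $ \<mu>" for y :: "real^'m"
    by (rule interior_subeigencone_iff[symmetric, OF mean_block block_le that[rule_format]])
  show ?thesis
    by (intro conjI allI impI vis_iff svis_iff sub_iff int_iff) (erule spec)+
qed

end
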